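(* Suppose $(\mathbf{C},\mathcal{M})$ is a small geometric $\mathcal{M}$-category and let $J$ be the Grothendieck topology on $\mathbf{C}$ generated by the basis whose basic covers of an object $C\in\mathbf{C}$ are the families $\{a_i\colon C_i\to C\}_{i\in I}$ with all $a_i\in\mathcal{M}$ and $\bigvee_{i\in I}a_i=1$ in $\mathsf{Sub}_{\mathcal{M}}(C)$. Then $J$ is subcanonical (i.e. every representable presheaf on $\mathbf{C}$ is a $J$-sheaf).
   Context: All categories are locally small unless stated otherwise; families are indexed by sets. Restriction categories. A restriction category is a category $\mathbf{X}$ with an assignment $f\mapsto \bar f$, $\mathbf{X}(A,B)\to\mathbf{X}(A,A)$, satisfying, for suitable maps, (R1) $f\bar f=f$; (R2) $\bar g\bar f=\bar f\bar g$; (R3) $\overline{g\bar f}=\bar g\bar f$; (R4) $\bar h f=f\,\overline{hf}$. Hom-sets are partially ordered by $f\le g$ iff $f=g\bar f$. Maps $f,g\in\mathbf{X}(A,B)$ are compatible if $f\bar g=g\bar f$; a set of parallel maps is compatible if its elements are pairwise compatible. A join restriction category is a restriction category in which every compatible set $S\subset\mathbf{X}(A,B)$ has a join $\bigvee_{s\in S}s$ in the poset $\mathbf{X}(A,B)$ satisfying (J1) $\overline{\bigvee_{s\in S}s}=\bigvee_{s\in S}\bar s$ and (J2) $(\bigvee_{s\in S}s)\circ g=\bigvee_{s\in S}(s\circ g)$. $\mathcal{M}$-categories. An $\mathcal{M}$-category $(\mathbf{C},\mathcal{M})$ is a category $\mathbf{C}$ with a family $\mathcal{M}$ of monics containing all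 isomorphisms, closed under composition, and such that the pullback of any $m\in\mathcal{M}$ along any map exists and is in $\mathcal{M}$. $\mathsf{Sub}_{\mathcal{M}}(C)$ is the poset (assumed small) of $\mathcal{M}$-subobjects of $C$, i.e. isomorphism classes of maps in $\mathcal{M}$ with codomain $C$, ordered by $m\le n$ iff $m$ factors through $n$. $\mathsf{Par}(\mathbf{C},\mathcal{M})$ has the objects of $\mathbf{C}$; its morphisms $A\to B$ are isomorphism classes of spans $(m,f)$ with $m\colon C\to A$ in $\mathcal{M}$ and $f\colon C\to B$, composed by pullback; it is a restriction category with $\overline{(m,f)}=(m,m)$. $(\mathbf{C},\mathcal{M})$ is geometric if $\mathsf{Par}(\mathbf{C},\mathcal{M})$ is a join restriction category, and small if $\mathbf{C}$ is small. When $(\mathbf{C},\mathcal{M})$ is geometric, $\mathsf{Sub}_{\mathcal{M}}(C)$ has all joins, the join of $\{a_i\colon C_i\to C\}_{i\in I}$ being the map $\bigcup_{i\in I}C_i\to C$ induced from the colimit $\bigcup_{i\in I}C_i$ of the diagram formed by the $C_i$, the pairwise pullbacks $C_i\times_C C_j$ ($i\ne j$) and their projections. *)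

theory Defs
  imports Main "HOL-Algebra.Order"
begin

text \<open>
  The objects and the arrows of a category form sets, so every category below is small.
  The composite \<open>g \<cdot> f\<close> (first \<open>f\<close>, then \<open>g\<close>) is only constrained when \<open>Cod f = Dom g\<close>.
\<close>

record ('o, 'a) cat =
  Obj :: "'o set"
  Arr :: "'a set"
  Dom :: "'a \<Rightarrow> 'o"
  Cod :: "'a \<Rightarrow> 'o"
  Id :: "'o \<Rightarrow> 'a"
  Comp :: "'a \<Rightarrow> 'a \<Rightarrow> 'a"  (infixl "\<cdot>\<index>" 70)

definition homset :: "('o, 'a, 'z) cat_scheme \<Rightarrow> 'o \<Rightarrow> 'o \<Rightarrow> 'a set" where
  "homset C A B = {f \<in> Arr C. Dom C f = A \<and> Cod C f = B}"

locale category =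
  fixes C :: "('o, 'a, 'z) cat_scheme" (structure)
  assumes dom_in_Obj: "f \<in> Arr C \<Longrightarrow> Dom C f \<in> Obj C"
    and cod_in_Obj: "f \<in> Arr C \<Longrightarrow> Cod C f \<in> Obj C"
    and id_in_hom: "A \<in> Obj C \<Longrightarrow> Id C A \<in> homset C A A"
    and comp_in_hom: "f \<in> homset C A B \<Longrightarrow> g \<in> homset C B D \<Longrightarrow> g \<cdot> f \<in> homset C A D"
    and comp_id: "f \<in> homset C A B \<Longrightarrow> f \<cdot> Id C A = f"
    and id_comp: "f \<in> homset C A B \<Longrightarrow> Id C B \<cdot> f = f"
    and comp_assoc: "f \<in> homset C A B \<Longrightarrow> g \<in> homset C B D \<Longrightarrow> h \<in> homset C D E \<Longrightarrow>
      (h \<cdot> g) \<cdot> f = h \<cdot> (g \<cdot> f)"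

definition isomorphisms :: "('o, 'a, 'z) cat_scheme \<Rightarrow> 'a set" where
  "isomorphisms C = {f \<in> Arr C. \<exists>g \<in> homset C (Cod C f) (Dom C f).
     g \<cdot>\<^bsub>C\<^esub> f = Id C (Dom C f) \<and> f \<cdot>\<^bsub>C\<^esub> g = Id C (Cod C f)}"

definition monics :: "('o, 'a, 'z) cat_scheme \<Rightarrow> 'a set" where
  "monics C = {m \<in> Arr C. \<forall>A \<in> Obj C. \<forall>f \<in> homset C A (Dom C m). \<forall>g \<in> homset C A (Dom C m).
     m \<cdot>\<^bsub>C\<^esub> f = m \<cdot>\<^bsub>C\<^esub> g \<longrightarrow> f = g}"

text \<open>\<open>is_pullback C f n p q\<close>: the square \<open>f \<cdot> p = n \<cdot> q\<close> is a pullback of the cospan \<open>(f, n)\<close>.\<close>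

definition is_pullback :: "('o, 'a, 'z) cat_scheme \<Rightarrow> 'a \<Rightarrow> 'a \<Rightarrow> 'a \<Rightarrow> 'a \<Rightarrow> bool" where
  "is_pullback C f n p q \<longleftrightarrow>
     f \<in> Arr C \<and> n \<in> Arr C \<and> Cod C f = Cod C n \<and>
     p \<in> homset C (Dom C p) (Dom C f) \<and> q \<in> homset C (Dom C p) (Dom C n) \<and>
     f \<cdot>\<^bsub>C\<^esub> p = n \<cdot>\<^bsub>C\<^esub> q \<and>
     (\<forall>A \<in> Obj C. \<forall>u \<in> homset C A (Dom C f). \<forall>v \<in> homset C A (Dom C n).
        f \<cdot>\<^bsub>C\<^esub> u = n \<cdot>\<^bsub>C\<^esub> v \<longrightarrow>
        (\<exists>!w. w \<in> homset C A (Dom C p) \<and> p \<cdot>\<^bsub>C\<^esub> w = u \<and> q \<cdot>\<^bsub>C\<^esub> w = v))"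

locale restriction_category = category C
  for C :: "('o, 'a, 'z) cat_scheme" (structure) +
  fixes r :: "'a \<Rightarrow> 'a"
  assumes restr_in_hom: "f \<in> homset C A B \<Longrightarrow> r f \<in> homset C A A"
    and R1: "f \<in> homset C A B \<Longrightarrow> f \<cdot> r f = f"
    and R2: "f \<in> homset C A B \<Longrightarrow> g \<in> homset C A D \<Longrightarrow> r g \<cdot> r f = r f \<cdot> r g"
    and R3: "f \<in> homset C A B \<Longrightarrow> g \<in> homset C A D \<Longrightarrow> r (g \<cdot> r f) = r g \<cdot> r f"
    and R4: "f \<in> homset C A B \<Longrightarrow> h \<in> homset C B D \<Longrightarrow> r h \<cdot> f = f \<cdot> r (h \<cdot> f)"

definition hom_poset ::
    "('o, 'a, 'z) cat_scheme \<Rightarrow> ('a \<Rightarrow> 'a) \<Rightarrow> 'o \<Rightarrow> 'o \<Rightarrow> 'a gorder" where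
  "hom_poset C r A B =
     \<lparr>carrier = homset C A B, eq = (=), le = (\<lambda>f g. f = g \<cdot>\<^bsub>C\<^esub> r f)\<rparr>"

definition is_join :: "('a, 'z) gorder_scheme \<Rightarrow> 'a set \<Rightarrow> 'a \<Rightarrow> bool" where
  "is_join L S j \<longleftrightarrow> least L j (Upper L S)"

definition compatible_set :: "('o, 'a, 'z) cat_scheme \<Rightarrow> ('a \<Rightarrow> 'a) \<Rightarrow> 'a set \<Rightarrow> bool" where
  "compatible_set C r S \<longleftrightarrow> (\<forall>f \<in> S. \<forall>g \<in> S. f \<cdot>\<^bsub>C\<^esub> r g = g \<cdot>\<^bsub>C\<^esub> r f)"

text \<open>
  Joins in a poset are unique, so (J1) and (J2) may be stated for the join \<open>j\<close> obtained here;
  the joins on the right-hand sides of (J1) and (J2) are taken in the respective hom-posets.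
\<close>

locale join_restriction_category = restriction_category C r
  for C :: "('o, 'a, 'z) cat_scheme" (structure) and r :: "'a \<Rightarrow> 'a" +
  assumes joins: "\<lbrakk>A \<in> Obj C; B \<in> Obj C; S \<subseteq> homset C A B; compatible_set C r S\<rbrakk> \<Longrightarrow>
    \<exists>j. is_join (hom_poset C r A B) S j \<and>
        is_join (hom_poset C r A A) (r ` S) (r j) \<and>
        (\<forall>D \<in> Obj C. \<forall>g \<in> homset C D A. is_join (hom_poset C r D B) ((\<lambda>s. s \<cdot> g) ` S) (j \<cdot> g))"

locale M_category = category C
  for C :: "('o, 'a, 'z) cat_scheme" (structure) +
  fixes M :: "'a set"
  assumes M_monic: "M \<subseteq> monics C"
    and iso_in_M: "isomorphisms C \<subseteq> M"
    and comp_in_M: "m \<in> M \<Longrightarrow> n \<in> M \<Longrightarrow> Cod C m = Dom C n \<Longrightarrow> n \<cdot> m \<in> M"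
    and pullback_in_M: "m \<in> M \<Longrightarrow> f \<in> Arr C \<Longrightarrow> Cod C f = Cod C m \<Longrightarrow>
      \<exists>p q. is_pullback C f m p q \<and> p \<in> M"

definition sub_iso :: "('o, 'a, 'z) cat_scheme \<Rightarrow> 'a set \<Rightarrow> 'o \<Rightarrow> ('a \<times> 'a) set" where
  "sub_iso C M X = {(m, n). m \<in> M \<and> n \<in> M \<and> Cod C m = X \<and> Cod C n = X \<and>
     (\<exists>i \<in> isomorphisms C. i \<in> homset C (Dom C m) (Dom C n) \<and> m = n \<cdot>\<^bsub>C\<^esub> i)}"

definition sub_class :: "('o, 'a, 'z) cat_scheme \<Rightarrow> 'a set \<Rightarrow> 'a \<Rightarrow> 'a set" where
  "sub_class C M m = sub_iso C M (Cod C m) `` {m}"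

definition Sub :: "('o, 'a, 'z) cat_scheme \<Rightarrow> 'a set \<Rightarrow> 'o \<Rightarrow> 'a set gorder" where
  "Sub C M X =
     \<lparr>carrier = {m \<in> M. Cod C m = X} // sub_iso C M X, eq = (=),
      le = (\<lambda>P Q. \<exists>m \<in> P. \<exists>n \<in> Q. \<exists>k \<in> homset C (Dom C m) (Dom C n). m = n \<cdot>\<^bsub>C\<^esub> k)\<rparr>"

text \<open>A span \<open>(m, f)\<close> represents a partial map from \<open>Cod m\<close> to \<open>Cod f\<close>.\<close>

definition spans :: "('o, 'a, 'z) cat_scheme \<Rightarrow> 'a set \<Rightarrow> ('a \<times> 'a) set" where
  "spans C M = {(m, f). m \<in> M \<and> f \<in> Arr C \<and> Dom C m = Dom C f}"

definition span_iso ::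
    "('o, 'a, 'z) cat_scheme \<Rightarrow> 'a set \<Rightarrow> (('a \<times> 'a) \<times> ('a \<times> 'a)) set" where
  "span_iso C M = {((m, f), (n, g)). (m, f) \<in> spans C M \<and> (n, g) \<in> spans C M \<and>
     (\<exists>i \<in> isomorphisms C. i \<in> homset C (Dom C m) (Dom C n) \<and>
        m = n \<cdot>\<^bsub>C\<^esub> i \<and> f = g \<cdot>\<^bsub>C\<^esub> i)}"

definition span_class ::
    "('o, 'a, 'z) cat_scheme \<Rightarrow> 'a set \<Rightarrow> 'a \<Rightarrow> 'a \<Rightarrow> ('a \<times> 'a) set" where
  "span_class C M m f = span_iso C M `` {(m, f)}"

text \<open>
  All members of a class of spans have the same outer objects, and all choices of representatives
  and of a pullback yield the same class, so the images and unions below are over constant families.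
\<close>

definition Par :: "('o, 'a, 'z) cat_scheme \<Rightarrow> 'a set \<Rightarrow> ('o, ('a \<times> 'a) set) cat" where
  "Par C M =
     \<lparr>Obj = Obj C,
      Arr = spans C M // span_iso C M,
      Dom = (\<lambda>F. the_elem ((\<lambda>(m, f). Cod C m) ` F)),
      Cod = (\<lambda>F. the_elem ((\<lambda>(m, f). Cod C f) ` F)),
      Id = (\<lambda>A. span_class C M (Id C A) (Id C A)),
      Comp = (\<lambda>G F. \<Union> {span_class C M (m \<cdot>\<^bsub>C\<^esub> p) (g \<cdot>\<^bsub>C\<^esub> q) | m f n g p q.
         (m, f) \<in> F \<and> (n, g) \<in> G \<and> is_pullback C f n p q})\<rparr>"

definition par_restr ::
    "('o, 'a, 'z) cat_scheme \<Rightarrow> 'a set \<Rightarrow> ('a \<times> 'a) set \<Rightarrow> ('a \<times> 'a) set" where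
  "par_restr C M F = (\<Union>(m, f) \<in> F. span_class C M m m)"

locale geometric_M_category = M_category C M
  for C :: "('o, 'a, 'z) cat_scheme" (structure) and M :: "'a set" +
  assumes geometric: "join_restriction_category (Par C M) (par_restr C M)"

record ('o, 'a, 'x) presheaf =
  PObj :: "'o \<Rightarrow> 'x set"
  PMap :: "'a \<Rightarrow> 'x \<Rightarrow> 'x"

definition is_presheaf :: "('o, 'a, 'z) cat_scheme \<Rightarrow> ('o, 'a, 'x) presheaf \<Rightarrow> bool" where
  "is_presheaf C F \<longleftrightarrow>
     (\<forall>f \<in> Arr C. \<forall>x \<in> PObj F (Cod C f). PMap F f x \<in> PObj F (Dom C f)) \<and>
     (\<forall>A \<in> Obj C. \<forall>x \<in> PObj F A. PMap F (Id C A) x = x) \<and>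
     (\<forall>f \<in> Arr C. \<forall>g \<in> Arr C. Cod C f = Dom C g \<longrightarrow>
        (\<forall>x \<in> PObj F (Cod C g). PMap F (g \<cdot>\<^bsub>C\<^esub> f) x = PMap F f (PMap F g x)))"

definition presheaf_iso :: "('o, 'a, 'z) cat_scheme \<Rightarrow>
    ('o, 'a, 'x) presheaf \<Rightarrow> ('o, 'a, 'y) presheaf \<Rightarrow> ('o \<Rightarrow> 'x \<Rightarrow> 'y) \<Rightarrow> bool" where
  "presheaf_iso C F G \<eta> \<longleftrightarrow>
     (\<forall>A \<in> Obj C. bij_betw (\<eta> A) (PObj F A) (PObj G A)) \<and>
     (\<forall>f \<in> Arr C. \<forall>x \<in> PObj F (Cod C f).
        \<eta> (Dom C f) (PMap F f x) = PMap G f (\<eta> (Cod C f) x))"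

definition hom_presheaf :: "('o, 'a, 'z) cat_scheme \<Rightarrow> 'o \<Rightarrow> ('o, 'a, 'a) presheaf" where
  "hom_presheaf C Y = \<lparr>PObj = (\<lambda>A. homset C A Y), PMap = (\<lambda>f g. g \<cdot>\<^bsub>C\<^esub> f)\<rparr>"

definition representable :: "('o, 'a, 'z) cat_scheme \<Rightarrow> ('o, 'a, 'x) presheaf \<Rightarrow> bool" where
  "representable C F \<longleftrightarrow>
     is_presheaf C F \<and> (\<exists>Y \<in> Obj C. \<exists>\<eta>. presheaf_iso C (hom_presheaf C Y) F \<eta>)"

definition sieves :: "('o, 'a, 'z) cat_scheme \<Rightarrow> 'o \<Rightarrow> 'a set set" where
  "sieves C X = {S. S \<subseteq> {f \<in> Arr C. Cod C f = X} \<and>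
     (\<forall>f \<in> S. \<forall>g \<in> Arr C. Cod C g = Dom C f \<longrightarrow> f \<cdot>\<^bsub>C\<^esub> g \<in> S)}"

text \<open>
  For a basis \<open>K\<close> (where \<open>K X\<close> consists of the basic covers of \<open>X\<close>), the covering sieves of the
  Grothendieck topology it generates are exactly the sieves that contain a basic cover.
\<close>

definition generated_topology ::
    "('o, 'a, 'z) cat_scheme \<Rightarrow> ('o \<Rightarrow> 'a set set) \<Rightarrow> 'o \<Rightarrow> 'a set set" where
  "generated_topology C K X = {S \<in> sieves C X. \<exists>R \<in> K X. R \<subseteq> S}"

definition matching_family ::
    "('o, 'a, 'z) cat_scheme \<Rightarrow> ('o, 'a, 'x) presheaf \<Rightarrow> 'a set \<Rightarrow> ('a \<Rightarrow> 'x) \<Rightarrow> bool" where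
  "matching_family C F S x \<longleftrightarrow>
     (\<forall>f \<in> S. x f \<in> PObj F (Dom C f)) \<and>
     (\<forall>f \<in> S. \<forall>g \<in> Arr C. Cod C g = Dom C f \<longrightarrow> x (f \<cdot>\<^bsub>C\<^esub> g) = PMap F g (x f))"

definition is_sheaf ::
    "('o, 'a, 'z) cat_scheme \<Rightarrow> ('o \<Rightarrow> 'a set set) \<Rightarrow> ('o, 'a, 'x) presheaf \<Rightarrow> bool" where
  "is_sheaf C J F \<longleftrightarrow> is_presheaf C F \<and>
     (\<forall>X \<in> Obj C. \<forall>S \<in> J X. \<forall>x. matching_family C F S x \<longrightarrow>
        (\<exists>!y. y \<in> PObj F X \<and> (\<forall>f \<in> S. PMap F f y = x f)))"

text \<open>The type argument is the type in which the representable presheaves take their values.\<close>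

definition subcanonical ::
    "'x itself \<Rightarrow> ('o, 'a, 'z) cat_scheme \<Rightarrow> ('o \<Rightarrow> 'a set set) \<Rightarrow> bool" where
  "subcanonical _ C J \<longleftrightarrow> (\<forall>F :: ('o, 'a, 'x) presheaf. representable C F \<longrightarrow> is_sheaf C J F)"

text \<open>
  A basic cover is given by the set of members of the family: repetitions change neither the join
  nor the sieves containing the family. The empty family is allowed.
\<close>

definition M_covers :: "('o, 'a, 'z) cat_scheme \<Rightarrow> 'a set \<Rightarrow> 'o \<Rightarrow> 'a set set" where
  "M_covers C M X = {R. R \<subseteq> {a \<in> M. Cod C a = X} \<and>
     is_join (Sub C M X) (sub_class C M ` R) (sub_class C M (Id C X))}"

end

theory Submission
  imports Defs
begin

text \<open>
  The total maps of \<open>Par C M\<close> are the maps of \<open>C\<close>, and a matching family \<open>x\<close> on a basic cover \<open>R\<close>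
  is a compatible family of partial maps \<open>(a, x a)\<close>. Its join has domain of definition \<open>\<Or>R = 1\<close>
  by (J1), so it is total and amalgamates \<open>x\<close>. By (J2), basic covers are stable under pullback,
  and by (J1) again two total maps that agree on a basic cover are equal; this gives uniqueness
  as well as agreement of the amalgamation with \<open>x\<close> on the whole sieve.
\<close>

section \<open>Isomorphisms and pullbacks\<close>

text \<open>Two orders have to be matched: a basic cover is a statement about joins in
  \<open>Sub C M X\<close>, while the geometric hypothesis speaks of joins in the hom-posets of
  \<open>Par C M\<close>. The bridge is the restriction idempotent of \<open>a\<close>, the class of
  \<open>(a, a)\<close>: a cover is handled as the set of these idempotents, with the identity as
  their join. The pulled-back cover is likewise kept in this form and not turned back into a
  statement about \<open>Sub\<close>. That \<open>Par C M\<close> is a category comes with the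
  hypothesis, but its composition is a union over all representatives and pullbacks. Independence of
  these choices is what makes composites computable.\<close>

lemma in_homsetD:
  assumes "f \<in> homset C A B"
  shows "f \<in> Arr C" "Dom C f = A" "Cod C f = B"
  using assms by (simp_all add: homset_def)

lemma is_pullbackD:
  assumes "is_pullback C f n p q"
  shows "f \<in> Arr C" "n \<in> Arr C" "Cod C f = Cod C n"
    "p \<in> homset C (Dom C p) (Dom C f)" "q \<in> homset C (Dom C p) (Dom C n)"
    "f \<cdot>\<^bsub>C\<^esub> p = n \<cdot>\<^bsub>C\<^esub> q"
  using assms unfolding is_pullback_def by blast+

lemma is_pullback_lift:
  assumes "is_pullback C f n p q" "A \<in> Obj C" "u \<in> homset C A (Dom C f)"
    "v \<in> homset C A (Dom C n)" "f \<cdot>\<^bsub>C\<^esub> u = n \<cdot>\<^bsub>C\<^esub> v"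
  shows "\<exists>!w. w \<in> homset C A (Dom C p) \<and> p \<cdot>\<^bsub>C\<^esub> w = u \<and> q \<cdot>\<^bsub>C\<^esub> w = v"
  using assms unfolding is_pullback_def by blast

lemma isomorphismE:
  assumes "i \<in> isomorphisms C" "i \<in> homset C A B"
  obtains j where "j \<in> isomorphisms C" "j \<in> homset C B A"
    "j \<cdot>\<^bsub>C\<^esub> i = Id C A" "i \<cdot>\<^bsub>C\<^esub> j = Id C B"
  using assms unfolding isomorphisms_def homset_def by auto

lemma isomorphismI:
  assumes "i \<in> homset C A B" "j \<in> homset C B A" "j \<cdot>\<^bsub>C\<^esub> i = Id C A" "i \<cdot>\<^bsub>C\<^esub> j = Id C B"
  shows "i \<in> isomorphisms C"
  using assms unfolding isomorphisms_def homset_def by auto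

lemma monicD:
  assumes "m \<in> monics C" "A \<in> Obj C" "f \<in> homset C A (Dom C m)" "g \<in> homset C A (Dom C m)"
    "m \<cdot>\<^bsub>C\<^esub> f = m \<cdot>\<^bsub>C\<^esub> g"
  shows "f = g"
  using assms unfolding monics_def by blast

context category
begin

lemma hom_Obj:
  assumes "f \<in> homset C A B"
  shows "A \<in> Obj C" "B \<in> Obj C"
  using assms dom_in_Obj cod_in_Obj by (auto simp: homset_def)

lemma id_isomorphism: "A \<in> Obj C \<Longrightarrow> Id C A \<in> isomorphisms C"
  using isomorphismI[OF id_in_hom id_in_hom] comp_id[OF id_in_hom] by simp

lemma comp_isomorphism:
  assumes "i \<in> isomorphisms C" "i \<in> homset C A B" "j \<in> isomorphisms C" "j \<in> homset C B D"
  shows "j \<cdot> i \<in> isomorphisms C"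
proof -
  obtain i' where i': "i' \<in> homset C B A" "i' \<cdot> i = Id C A" "i \<cdot> i' = Id C B"
    using assms(1,2) by (rule isomorphismE)
  obtain j' where j': "j' \<in> homset C D B" "j' \<cdot> j = Id C B" "j \<cdot> j' = Id C D"
    using assms(3,4) by (rule isomorphismE)
  note ji = comp_in_hom[OF assms(2,4)] and ij' = comp_in_hom[OF j'(1) i'(1)]
  have "(i' \<cdot> j') \<cdot> (j \<cdot> i) = i' \<cdot> ((j' \<cdot> j) \<cdot> i)"
    using comp_assoc[OF ji j'(1) i'(1)] comp_assoc[OF assms(2,4) j'(1)] by simp
  also have "\<dots> = Id C A" using i'(2) j'(2) id_comp[OF assms(2)] by simp
  finally have 1: "(i' \<cdot> j') \<cdot> (j \<cdot> i) = Id C A" .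
  have "(j \<cdot> i) \<cdot> (i' \<cdot> j') = j \<cdot> ((i \<cdot> i') \<cdot> j')"
    using comp_assoc[OF ij' assms(2,4)] comp_assoc[OF j'(1) i'(1) assms(2)] by simp
  also have "\<dots> = Id C D" using i'(3) j'(3) id_comp[OF j'(1)] by simp
  finally show ?thesis using isomorphismI[OF ji ij' 1] by simp
qed

text \<open>This square computes the composite of a partial map followed by a total one, whose left
  leg is an identity.\<close>

lemma pullback_id_right:
  assumes "f \<in> homset C A B"
  shows "is_pullback C f (Id C B) (Id C A) f"
  unfolding is_pullback_def
proof (intro conjI ballI impI)
  note O = hom_Obj[OF assms]
  note hA = id_in_hom[OF O(1)] and hB = id_in_hom[OF O(2)]
  show "f \<in> Arr C" "Id C B \<in> Arr C" "Cod C f = Cod C (Id C B)"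
    "Id C A \<in> homset C (Dom C (Id C A)) (Dom C f)"
    "f \<in> homset C (Dom C (Id C A)) (Dom C (Id C B))"
    using assms hA hB by (auto simp: homset_def)
  show "f \<cdot> Id C A = Id C B \<cdot> f" using comp_id[OF assms] id_comp[OF assms] by simp
  fix D u v
  assume "D \<in> Obj C" and u: "u \<in> homset C D (Dom C f)" and v: "v \<in> homset C D (Dom C (Id C B))"
    and e: "f \<cdot> u = Id C B \<cdot> v"
  have "u \<in> homset C D A" "v \<in> homset C D B" "Dom C (Id C A) = A"
    using u v assms hA hB by (auto simp: homset_def)
  with e show "\<exists>!w. w \<in> homset C D (Dom C (Id C A)) \<and> Id C A \<cdot> w = u \<and> f \<cdot> w = v"
    using id_comp by metis
qed

lemma pullback_sym:
  assumes "is_pullback C f n p q"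
  shows "is_pullback C n f q p"
proof -
  note d = is_pullbackD[OF assms]
  have D: "Dom C q = Dom C p" using in_homsetD(2)[OF d(5)] .
  show ?thesis
    unfolding is_pullback_def D
  proof (intro conjI ballI impI)
    fix A u v
    assume "A \<in> Obj C" "u \<in> homset C A (Dom C n)" "v \<in> homset C A (Dom C f)" "n \<cdot> u = f \<cdot> v"
    then have "\<exists>!w. w \<in> homset C A (Dom C p) \<and> p \<cdot> w = v \<and> q \<cdot> w = u"
      by (intro is_pullback_lift[OF assms]) auto
    then show "\<exists>!w. w \<in> homset C A (Dom C p) \<and> q \<cdot> w = u \<and> p \<cdot> w = v"
      by (simp add: conj_commute)
  qed (use d in auto)
qed

lemma pullback_unique:
  assumes "is_pullback C f n p q" "is_pullback C f n p' q'"
  obtains i where "i \<in> isomorphisms C" "i \<in> homset C (Dom C p) (Dom C p')"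
    "p = p' \<cdot> i" "q = q' \<cdot> i"
proof -
  note d = is_pullbackD[OF assms(1)] and d' = is_pullbackD[OF assms(2)]
  note O = hom_Obj(1)[OF d(4)] and O' = hom_Obj(1)[OF d'(4)]
  obtain i where i: "i \<in> homset C (Dom C p) (Dom C p')" "p' \<cdot> i = p" "q' \<cdot> i = q"
    using is_pullback_lift[OF assms(2) O d(4) d(5) d(6)] by blast
  obtain j where j: "j \<in> homset C (Dom C p') (Dom C p)" "p \<cdot> j = p'" "q \<cdot> j = q'"
    using is_pullback_lift[OF assms(1) O' d'(4) d'(5) d'(6)] by blast
  have ji: "j \<cdot> i \<in> homset C (Dom C p) (Dom C p)" "p \<cdot> (j \<cdot> i) = p" "q \<cdot> (j \<cdot> i) = q"
    using i j comp_in_hom[OF i(1) j(1)] comp_assoc[OF i(1) j(1) d(4)] comp_assoc[OF i(1) j(1) d(5)]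
    by simp_all
  have ij: "i \<cdot> j \<in> homset C (Dom C p') (Dom C p')" "p' \<cdot> (i \<cdot> j) = p'" "q' \<cdot> (i \<cdot> j) = q'"
    using i j comp_in_hom[OF j(1) i(1)] comp_assoc[OF j(1) i(1) d'(4)] comp_assoc[OF j(1) i(1) d'(5)]
    by simp_all
  have "j \<cdot> i = Id C (Dom C p)"
    using is_pullback_lift[OF assms(1) O d(4) d(5) d(6)] ji
      id_in_hom[OF O] comp_id[OF d(4)] comp_id[OF d(5)] by blast
  moreover have "i \<cdot> j = Id C (Dom C p')"
    using is_pullback_lift[OF assms(2) O' d'(4) d'(5) d'(6)] ij
      id_in_hom[OF O'] comp_id[OF d'(4)] comp_id[OF d'(5)] by blast
  ultimately show ?thesis
    using that i isomorphismI[OF i(1) j(1)] by auto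
qed

text \<open>Lets a pullback follow a change of representative of one leg of the cospan. Together
  with \<open>pullback_sym\<close> it handles both legs.\<close>

lemma pullback_comp_isomorphism:
  assumes pb: "is_pullback C (f \<cdot> i) n p q"
    and i: "i \<in> isomorphisms C" "i \<in> homset C D (Dom C f)" and f: "f \<in> Arr C"
  shows "is_pullback C f n (i \<cdot> p) q"
proof -
  note d = is_pullbackD[OF pb]
  have fh: "f \<in> homset C (Dom C f) (Cod C f)" using f by (simp add: homset_def)
  have fi: "f \<cdot> i \<in> homset C D (Cod C f)" using comp_in_hom[OF i(2) fh] .
  have ph: "p \<in> homset C (Dom C p) D" using d(4) in_homsetD(2)[OF fi] by simp
  have ip: "i \<cdot> p \<in> homset C (Dom C p) (Dom C f)" using comp_in_hom[OF ph i(2)] .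
  have D: "Dom C (i \<cdot> p) = Dom C p" using in_homsetD(2)[OF ip] .
  obtain j where j: "j \<in> homset C (Dom C f) D" "j \<cdot> i = Id C D" "i \<cdot> j = Id C (Dom C f)"
    using i by (rule isomorphismE)
  show ?thesis
    unfolding is_pullback_def D
  proof (intro conjI ballI impI)
    show "f \<in> Arr C" "n \<in> Arr C" "Cod C f = Cod C n" using f d in_homsetD[OF fi] by auto
    show "i \<cdot> p \<in> homset C (Dom C p) (Dom C f)" "q \<in> homset C (Dom C p) (Dom C n)"
      using ip d by auto
    show "f \<cdot> (i \<cdot> p) = n \<cdot> q" using comp_assoc[OF ph i(2) fh] d(6) by simp
    fix A u v
    assume A: "A \<in> Obj C" and u: "u \<in> homset C A (Dom C f)" and v: "v \<in> homset C A (Dom C n)"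
      and e: "f \<cdot> u = n \<cdot> v"
    have ju: "j \<cdot> u \<in> homset C A D" using comp_in_hom[OF u j(1)] .
    have iju: "i \<cdot> (j \<cdot> u) = u" using comp_assoc[OF u j(1) i(2)] j(3) id_comp[OF u] by simp
    have "(f \<cdot> i) \<cdot> (j \<cdot> u) = n \<cdot> v" using comp_assoc[OF ju i(2) fh] iju e by simp
    then have "\<exists>!w. w \<in> homset C A (Dom C p) \<and> p \<cdot> w = j \<cdot> u \<and> q \<cdot> w = v"
      using is_pullback_lift[OF pb A _ v] ju in_homsetD(2)[OF fi] by simp
    \<comment> \<open>The two lifting problems have the same solutions \<open>w\<close>, so
      existence and uniqueness carry over together.\<close>
    moreover have "p \<cdot> w = j \<cdot> u \<longleftrightarrow> (i \<cdot> p) \<cdot> w = u" if w: "w \<in> homset C A (Dom C p)" for w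
    proof -
      have pw: "p \<cdot> w \<in> homset C A D" using comp_in_hom[OF w ph] .
      have "j \<cdot> (i \<cdot> (p \<cdot> w)) = p \<cdot> w" using comp_assoc[OF pw i(2) j(1)] j(2) id_comp[OF pw] by simp
      then show ?thesis using comp_assoc[OF w ph i(2)] iju by metis
    qed
    ultimately show "\<exists>!w. w \<in> homset C A (Dom C p) \<and> (i \<cdot> p) \<cdot> w = u \<and> q \<cdot> w = v"
      by metis
  qed
qed

end

section \<open>Joins in a restriction category\<close>

context restriction_category
begin

text \<open>\<open>Upper\<close> tests only those members of \<open>S\<close> that lie in the
  carrier, hence the assumption that \<open>S\<close> is part of the hom-set.\<close>

lemma is_join_hom_poset_iff:
  assumes "S \<subseteq> homset C A B"
  shows "is_join (hom_poset C r A B) S j \<longleftrightarrow>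
    j \<in> homset C A B \<and> (\<forall>s \<in> S. s = j \<cdot> r s) \<and>
    (\<forall>u \<in> homset C A B. (\<forall>s \<in> S. s = u \<cdot> r s) \<longrightarrow> j = u \<cdot> r j)"
  using assms unfolding is_join_def hom_poset_def least_def Upper_def by (simp, blast)

text \<open>Two joins lie below each other, so this is antisymmetry of the restriction order: by
  (R2) the idempotents \<open>r j\<close> and \<open>r k\<close> commute, and (R1) absorbs
  \<open>r j\<close> into \<open>j\<close>.\<close>

lemma is_join_unique:
  assumes "S \<subseteq> homset C A B" "is_join (hom_poset C r A B) S j" "is_join (hom_poset C r A B) S k"
  shows "j = k"
proof -
  have h: "j \<in> homset C A B" "k \<in> homset C A B" and jk: "j = k \<cdot> r j" and kj: "k = j \<cdot> r k"
    using assms(2,3) unfolding is_join_hom_poset_iff[OF assms(1)] by blast+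
  have "j = (j \<cdot> r k) \<cdot> r j" using jk kj by metis
  also have "\<dots> = j \<cdot> (r j \<cdot> r k)"
    using comp_assoc[OF restr_in_hom[OF h(1)] restr_in_hom[OF h(2)] h(1)] R2[OF h] by metis
  also have "\<dots> = (j \<cdot> r j) \<cdot> r k"
    using comp_assoc[OF restr_in_hom[OF h(2)] restr_in_hom[OF h(1)] h(1)] by metis
  also have "\<dots> = k" using R1[OF h(1)] kj by metis
  finally show ?thesis .
qed

text \<open>(R3) with \<open>r e = e\<close>. A set of idempotents can thus be recovered, by taking
  restrictions, from its composites with a total map.\<close>

lemma restr_comp_idem:
  assumes "u \<in> homset C A B" "r u = Id C A" "e \<in> homset C A A" "r e = e"
  shows "r (u \<cdot> e) = e"
  using R3[OF assms(3,1)] assms(2,4) id_comp[OF assms(3)] by simp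

lemma idem_commute:
  assumes "e \<in> homset C A A" "e' \<in> homset C A A" "r e = e" "r e' = e'"
  shows "e \<cdot> e' = e' \<cdot> e"
  using R2[OF assms(2,1)] assms(3,4) by simp

lemma idems_compatible:
  assumes "E \<subseteq> homset C A A" "\<And>e. e \<in> E \<Longrightarrow> r e = e"
  shows "compatible_set C r E"
  unfolding compatible_set_def
proof (intro ballI)
  fix e e' assume "e \<in> E" "e' \<in> E"
  then have h: "e \<in> homset C A A" "r e = e" "e' \<in> homset C A A" "r e' = e'" using assms by auto
  show "e \<cdot> r e' = e' \<cdot> r e" unfolding h(2,4) using idem_commute[OF h(1,3,2,4)] .
qed

end

context join_restriction_category
begin

lemma compatible_amalgamation:
  assumes "A \<in> Obj C" "B \<in> Obj C" "S \<subseteq> homset C A B" "compatible_set C r S"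
    and "is_join (hom_poset C r A A) (r ` S) (Id C A)"
  obtains j where "j \<in> homset C A B" "r j = Id C A" "\<And>s. s \<in> S \<Longrightarrow> s = j \<cdot> r s"
proof -
  obtain j where j: "is_join (hom_poset C r A B) S j" "is_join (hom_poset C r A A) (r ` S) (r j)"
    using joins[OF assms(1-4)] by blast
  have "r ` S \<subseteq> homset C A A" using assms(3) restr_in_hom by blast
  then have "r j = Id C A" using is_join_unique j(2) assms(5) by blast
  with that j(1) show ?thesis unfolding is_join_hom_poset_iff[OF assms(3)] by blast
qed

text \<open>The maps \<open>u \<cdot> e\<close> form a compatible family whose restrictions are the
  members of \<open>E\<close>, so by (J1) its join \<open>j\<close> is total. Both \<open>u\<close>
  and \<open>v\<close> are upper bounds of this family, and a total map below another map equals
  it.\<close>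

lemma total_eq_on_join:
  assumes u: "u \<in> homset C A B" "r u = Id C A" and v: "v \<in> homset C A B" "r v = Id C A"
    and E: "E \<subseteq> homset C A A" "\<And>e. e \<in> E \<Longrightarrow> r e = e"
    and join: "is_join (hom_poset C r A A) E (Id C A)"
    and eq: "\<And>e. e \<in> E \<Longrightarrow> u \<cdot> e = v \<cdot> e"
  shows "u = v"
proof -
  note O = hom_Obj[OF u(1)]
  define S where "S = (\<lambda>e. u \<cdot> e) ` E"
  have S: "S \<subseteq> homset C A B" unfolding S_def using E(1) u(1) comp_in_hom by blast
  have rS: "r ` S = E"
    unfolding S_def image_image using restr_comp_idem[OF u] E by (auto simp: image_iff subset_iff)
  have "compatible_set C r S"
    unfolding compatible_set_def
  proof (intro ballI)
    fix f g assume "f \<in> S" "g \<in> S"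
    then obtain e e' where e: "e \<in> E" "f = u \<cdot> e" and e': "e' \<in> E" "g = u \<cdot> e'"
      unfolding S_def by blast
    have h: "e \<in> homset C A A" "r e = e" "e' \<in> homset C A A" "r e' = e'" using E e e' by auto
    have "f \<cdot> r g = u \<cdot> (e \<cdot> e')"
      using e e' h restr_comp_idem[OF u] comp_assoc[OF h(3) h(1) u(1)] by simp
    also have "\<dots> = u \<cdot> (e' \<cdot> e)" using idem_commute[OF h(1,3,2,4)] by metis
    also have "\<dots> = g \<cdot> r f"
      using e e' h restr_comp_idem[OF u] comp_assoc[OF h(1) h(3) u(1)] by simp
    finally show "f \<cdot> r g = g \<cdot> r f" .
  qed
  then obtain j where j: "is_join (hom_poset C r A B) S j" "is_join (hom_poset C r A A) (r ` S) (r j)"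
    using joins[OF O S] by blast
  have rj: "r j = Id C A" using is_join_unique[of E A A] E(1) rS j(2) join by simp
  \<comment> \<open>From \<open>j \<le> w\<close> comes \<open>j = w \<cdot> r j\<close>, and
    \<open>r j\<close> is the identity. The claim is used once for \<open>u\<close> and once for
    \<open>v\<close>.\<close>
  have eq_j: "j = w" if w: "w \<in> homset C A B" "\<And>e. e \<in> E \<Longrightarrow> u \<cdot> e = w \<cdot> e" for w
  proof -
    have "s = w \<cdot> r s" if "s \<in> S" for s
    proof -
      obtain e where e: "e \<in> E" "s = u \<cdot> e" using \<open>s \<in> S\<close> unfolding S_def by blast
      have "r s = e" using restr_comp_idem[OF u] E e by blast
      then show ?thesis using e w(2) by simp
    qed
    then have "j = w \<cdot> r j"
      using j(1) w(1) unfolding is_join_hom_poset_iff[OF S] by blast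
    then show ?thesis using rj comp_id[OF w(1)] by metis
  qed
  show ?thesis using eq_j[OF u(1) refl] eq_j[OF v(1) eq] by (rule subst)
qed

text \<open>By (J2) the maps \<open>e \<cdot> g\<close> have join \<open>g\<close>, and (J1) passes
  to their restrictions. In \<open>Par C M\<close>, with \<open>g\<close> total, this says that a
  cover stays a cover when pulled back along \<open>g\<close>.\<close>

lemma join_restr_comp:
  assumes g: "g \<in> homset C D A"
    and E: "E \<subseteq> homset C A A" "\<And>e. e \<in> E \<Longrightarrow> r e = e"
    and join: "is_join (hom_poset C r A A) E (Id C A)"
  shows "is_join (hom_poset C r D D) ((\<lambda>e. r (e \<cdot> g)) ` E) (r g)"
proof -
  note O = hom_Obj[OF g]
  obtain j where j: "is_join (hom_poset C r A A) E j"
    "is_join (hom_poset C r D A) ((\<lambda>s. s \<cdot> g) ` E) (j \<cdot> g)"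
    using joins[OF O(2) O(2) E(1) idems_compatible[OF E]] O(1) g by blast
  have "j = Id C A" using is_join_unique[OF E(1) j(1) join] .
  then have jg: "is_join (hom_poset C r D A) ((\<lambda>s. s \<cdot> g) ` E) g" using j(2) id_comp[OF g] by simp
  have S: "(\<lambda>s. s \<cdot> g) ` E \<subseteq> homset C D A" using E(1) g comp_in_hom by blast
  have "compatible_set C r ((\<lambda>s. s \<cdot> g) ` E)"
    unfolding compatible_set_def
  proof (clarify)
    fix e e' assume "e \<in> E" "e' \<in> E"
    then have h: "e \<in> homset C A A" "r e = e" "e' \<in> homset C A A" "r e' = e'" using E by auto
    \<comment> \<open>By (R4), \<open>b \<cdot> g = g \<cdot> r (b \<cdot> g)\<close>, so
      precomposing with this restriction amounts to inserting \<open>b\<close>. Compatibility then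
      reduces to the commutation of idempotents.\<close>
    have *: "(a \<cdot> g) \<cdot> r (b \<cdot> g) = (a \<cdot> b) \<cdot> g"
      if a: "a \<in> homset C A A" and b: "b \<in> homset C A A" "r b = b" for a b
    proof -
      have rb: "r (b \<cdot> g) \<in> homset C D D" using comp_in_hom[OF g b(1)] by (rule restr_in_hom)
      show ?thesis
        using comp_assoc[OF rb g a] comp_assoc[OF g b(1) a] R4[OF g b(1)] b(2) by metis
    qed
    show "(e \<cdot> g) \<cdot> r (e' \<cdot> g) = (e' \<cdot> g) \<cdot> r (e \<cdot> g)"
      using *[OF h(1,3,4)] *[OF h(3,1,2)] idem_commute[OF h(1,3,2,4)] by metis
  qed
  from joins[OF O S this] obtain k where
    "is_join (hom_poset C r D A) ((\<lambda>s. s \<cdot> g) ` E) k"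
    "is_join (hom_poset C r D D) (r ` (\<lambda>s. s \<cdot> g) ` E) (r k)" by blast
  \<comment> \<open>(J1) is available for the join \<open>k\<close> returned by
    \<open>joins\<close>; (J2) has already identified the join of this family as
    \<open>g\<close>.\<close>
  moreover from this have "k = g" using is_join_unique[OF S _ jg] by blast
  ultimately show ?thesis by (simp add: image_image)
qed

end

section \<open>Partial maps\<close>

context M_category
begin

lemma M_Arr: "m \<in> M \<Longrightarrow> m \<in> Arr C"
  using M_monic by (auto simp: monics_def)

lemma M_hom: "m \<in> M \<Longrightarrow> m \<in> homset C (Dom C m) (Cod C m)"
  by (simp add: M_Arr homset_def)

lemma M_cancel:
  "m \<in> M \<Longrightarrow> f \<in> homset C A (Dom C m) \<Longrightarrow> g \<in> homset C A (Dom C m) \<Longrightarrow> m \<cdot> f = m \<cdot> g \<Longrightarrow> f = g"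
  using M_monic monicD hom_Obj(1) by (metis subsetD)

lemma id_in_M: "A \<in> Obj C \<Longrightarrow> Id C A \<in> M"
  using id_isomorphism iso_in_M by blast

text \<open>The axiom provides only some pullback with its projection in \<open>M\<close>. Any other
  differs from it by an isomorphism, and \<open>M\<close> contains isomorphisms and is closed under
  composition.\<close>

lemma pullback_M:
  assumes "is_pullback C f n p q" "n \<in> M"
  shows "p \<in> M"
proof -
  note d = is_pullbackD[OF assms(1)]
  obtain p' q' where pb': "is_pullback C f n p' q'" "p' \<in> M" using pullback_in_M[OF assms(2) d(1,3)] by blast
  obtain i where i: "i \<in> isomorphisms C" "i \<in> homset C (Dom C p) (Dom C p')" "p = p' \<cdot> i"
    using pullback_unique[OF assms(1) pb'(1)] .
  show ?thesis using comp_in_M[of i p'] i pb'(2) iso_in_M in_homsetD[OF i(2)] by auto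
qed

section \<open>Isomorphism of spans\<close>

lemma spans_iff:
  "(m, f) \<in> spans C M \<longleftrightarrow> m \<in> M \<and> f \<in> homset C (Dom C m) (Cod C f)"
  unfolding spans_def homset_def by auto

lemma span_iso_iff:
  "((m, f), (n, g)) \<in> span_iso C M \<longleftrightarrow> (m, f) \<in> spans C M \<and> (n, g) \<in> spans C M \<and>
     (\<exists>i \<in> isomorphisms C. i \<in> homset C (Dom C m) (Dom C n) \<and> m = n \<cdot> i \<and> f = g \<cdot> i)"
  unfolding span_iso_def by simp

lemma span_iso_sym:
  assumes "((m, f), (n, g)) \<in> span_iso C M"
  shows "((n, g), (m, f)) \<in> span_iso C M"
proof -
  from assms obtain i where s: "(m, f) \<in> spans C M" "(n, g) \<in> spans C M"
    and i: "i \<in> isomorphisms C" "i \<in> homset C (Dom C m) (Dom C n)" "m = n \<cdot> i" "f = g \<cdot> i"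
    unfolding span_iso_iff by blast
  obtain j where j: "j \<in> isomorphisms C" "j \<in> homset C (Dom C n) (Dom C m)" "i \<cdot> j = Id C (Dom C n)"
    using i(1,2) by (rule isomorphismE)
  have n: "n \<in> homset C (Dom C n) (Cod C n)" and g: "g \<in> homset C (Dom C n) (Cod C g)"
    using s(2) M_hom unfolding spans_iff by auto
  have "m \<cdot> j = n" "f \<cdot> j = g"
    using i j comp_assoc[OF j(2) i(2) n] comp_assoc[OF j(2) i(2) g] comp_id[OF n] comp_id[OF g] by auto
  with s j show ?thesis unfolding span_iso_iff by auto
qed

lemma span_iso_trans:
  assumes "((m, f), (n, g)) \<in> span_iso C M" "((n, g), (k, h)) \<in> span_iso C M"
  shows "((m, f), (k, h)) \<in> span_iso C M"
proof -
  from assms(1) obtain i where s: "(m, f) \<in> spans C M" "(n, g) \<in> spans C M"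
    and i: "i \<in> isomorphisms C" "i \<in> homset C (Dom C m) (Dom C n)" "m = n \<cdot> i" "f = g \<cdot> i"
    unfolding span_iso_iff by blast
  from assms(2) obtain j where s': "(k, h) \<in> spans C M"
    and j: "j \<in> isomorphisms C" "j \<in> homset C (Dom C n) (Dom C k)" "n = k \<cdot> j" "g = h \<cdot> j"
    unfolding span_iso_iff by blast
  have k: "k \<in> homset C (Dom C k) (Cod C k)" and h: "h \<in> homset C (Dom C k) (Cod C h)"
    using s' M_hom unfolding spans_iff by auto
  have "m = k \<cdot> (j \<cdot> i)" "f = h \<cdot> (j \<cdot> i)"
    using i j comp_assoc[OF i(2) j(2) k] comp_assoc[OF i(2) j(2) h] by auto
  then show ?thesis
    using s s' comp_in_hom[OF i(2) j(2)] comp_isomorphism[OF i(1,2) j(1,2)]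
    unfolding span_iso_iff by blast
qed

lemma span_iso_refl: "(m, f) \<in> spans C M \<Longrightarrow> ((m, f), (m, f)) \<in> span_iso C M"
  unfolding span_iso_iff spans_iff
  by (metis M_hom comp_id hom_Obj(1) id_in_hom id_isomorphism)

lemma span_iso_equiv: "equiv (spans C M) (span_iso C M)"
proof (rule equivI)
  show "span_iso C M \<subseteq> spans C M \<times> spans C M" by (auto simp: span_iso_def)
  show "refl_on (spans C M) (span_iso C M)"
    by (auto simp: refl_on_def intro: span_iso_refl)
  show "sym (span_iso C M)" by (rule symI) (metis span_iso_sym surj_pair)
  show "trans (span_iso C M)" by (rule transI) (metis span_iso_trans surj_pair)
qed

lemma span_class_eq_iff:
  assumes "(m, f) \<in> spans C M" "(n, g) \<in> spans C M"
  shows "span_class C M m f = span_class C M n g \<longleftrightarrow>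
    (\<exists>i \<in> isomorphisms C. i \<in> homset C (Dom C m) (Dom C n) \<and> m = n \<cdot> i \<and> f = g \<cdot> i)"
  using eq_equiv_class_iff[OF span_iso_equiv assms] assms
  unfolding span_class_def span_iso_iff by simp

lemma mem_span_class_iff: "(n, g) \<in> span_class C M m f \<longleftrightarrow> ((m, f), (n, g)) \<in> span_iso C M"
  unfolding span_class_def by simp

text \<open>An isomorphism comparing the two spans fixes the monic \<open>m\<close>, so it is the
  identity. With \<open>m\<close> an identity this is faithfulness of the passage from
  \<open>C\<close> to \<open>Par C M\<close>; with \<open>m\<close> a member of a cover it turns
  equalities of partial maps into equalities of arrows.\<close>

lemma span_class_inject:
  assumes "(m, f) \<in> spans C M" "(m, g) \<in> spans C M" "span_class C M m f = span_class C M m g"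
  shows "f = g"
proof -
  obtain i where i: "i \<in> homset C (Dom C m) (Dom C m)" "m = m \<cdot> i" "f = g \<cdot> i"
    using assms(3) unfolding span_class_eq_iff[OF assms(1,2)] by blast
  have m: "m \<in> M" and g: "g \<in> homset C (Dom C m) (Cod C g)" using assms(2) unfolding spans_iff by auto
  note O = hom_Obj(1)[OF i(1)]
  have "i = Id C (Dom C m)"
    using M_cancel[OF m i(1) id_in_hom[OF O]] i(2) comp_id[OF M_hom[OF m]] by metis
  then show ?thesis using i(3) comp_id[OF g] by simp
qed

lemma span_iso_hom:
  assumes "((m, f), (n, g)) \<in> span_iso C M"
  shows "Cod C n = Cod C m" "Cod C g = Cod C f"
proof -
  from assms obtain i where s: "(n, g) \<in> spans C M"
    and i: "i \<in> homset C (Dom C m) (Dom C n)" "m = n \<cdot> i" "f = g \<cdot> i"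
    unfolding span_iso_iff by blast
  have n: "n \<in> homset C (Dom C n) (Cod C n)" and g: "g \<in> homset C (Dom C n) (Cod C g)"
    using s M_hom unfolding spans_iff by auto
  show "Cod C n = Cod C m" "Cod C g = Cod C f"
    using i in_homsetD(3)[OF comp_in_hom[OF i(1) n]] in_homsetD(3)[OF comp_in_hom[OF i(1) g]] by auto
qed

section \<open>Domain, codomain, restriction and composition in \<open>Par C M\<close>\<close>

lemma Dom_Cod_span_class:
  assumes "(m, f) \<in> spans C M"
  shows "Dom (Par C M) (span_class C M m f) = Cod C m"
    and "Cod (Par C M) (span_class C M m f) = Cod C f"
proof -
  have "(\<lambda>(m, f). Cod C m) ` span_class C M m f = {Cod C m}"
    "(\<lambda>(m, f). Cod C f) ` span_class C M m f = {Cod C f}"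
    using span_iso_refl[OF assms] by (force simp: mem_span_class_iff dest: span_iso_hom)+
  then show "Dom (Par C M) (span_class C M m f) = Cod C m"
    "Cod (Par C M) (span_class C M m f) = Cod C f"
    by (simp_all add: Par_def)
qed

lemma span_class_in_hom:
  assumes "(m, f) \<in> spans C M"
  shows "span_class C M m f \<in> homset (Par C M) (Cod C m) (Cod C f)"
  using Dom_Cod_span_class[OF assms] quotientI[OF assms]
  by (simp add: homset_def Par_def span_class_def)

lemma Par_homE:
  assumes "F \<in> homset (Par C M) A B"
  obtains m f where "(m, f) \<in> spans C M" "Cod C m = A" "Cod C f = B" "F = span_class C M m f"
proof -
  have "F \<in> spans C M // span_iso C M" using assms by (simp add: homset_def Par_def)
  then obtain m f where "(m, f) \<in> spans C M" "F = span_class C M m f"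
    by (auto simp: quotient_def span_class_def)
  then show ?thesis using that Dom_Cod_span_class in_homsetD[OF assms] by metis
qed

lemma par_restr_span_class:
  assumes "(m, f) \<in> spans C M"
  shows "par_restr C M (span_class C M m f) = span_class C M m m"
proof -
  have "span_class C M n n = span_class C M m m" if "(n, g) \<in> span_class C M m f" for n g
  proof -
    have "((n, g), (m, f)) \<in> span_iso C M" using that span_iso_sym by (simp add: mem_span_class_iff)
    then show ?thesis using M_hom by (auto simp: span_iso_iff span_class_eq_iff spans_iff)
  qed
  then have "par_restr C M (span_class C M m f) = (\<Union>F \<in> span_class C M m f. span_class C M m m)"
    unfolding par_restr_def by (intro SUP_cong) auto
  moreover have "span_class C M m f \<noteq> {}"
    using span_iso_refl[OF assms] mem_span_class_iff by blast
  ultimately show ?thesis by simp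
qed

text \<open>The isomorphisms \<open>i\<close> and \<open>j\<close> between representatives carry the
  pullback \<open>(p', q')\<close> to a second pullback \<open>(i \<cdot> p', j \<cdot> q')\<close>
  of the original cospan. The comparison \<open>k\<close> with \<open>(p, q)\<close> is then an
  isomorphism between the two composite spans.\<close>

lemma Comp_span_class_reps:
  assumes s: "(m, f) \<in> spans C M" "(n, g) \<in> spans C M" and pb: "is_pullback C f n p q"
    and F: "((m', f'), (m, f)) \<in> span_iso C M" and G: "((n', g'), (n, g)) \<in> span_iso C M"
    and pb': "is_pullback C f' n' p' q'"
  shows "span_class C M (m' \<cdot> p') (g' \<cdot> q') = span_class C M (m \<cdot> p) (g \<cdot> q)"
proof -
  have m: "m \<in> homset C (Dom C m) (Cod C m)" and f: "f \<in> homset C (Dom C m) (Cod C f)"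
    and n: "n \<in> homset C (Dom C n) (Cod C n)" and g: "g \<in> homset C (Dom C n) (Cod C g)"
    using s M_hom unfolding spans_iff by auto
  have D: "Dom C f = Dom C m" using in_homsetD(2)[OF f] .
  obtain i where i: "i \<in> isomorphisms C" "i \<in> homset C (Dom C m') (Dom C m)" "m' = m \<cdot> i" "f' = f \<cdot> i"
    using F unfolding span_iso_iff by blast
  obtain j where j: "j \<in> isomorphisms C" "j \<in> homset C (Dom C n') (Dom C n)" "n' = n \<cdot> j" "g' = g \<cdot> j"
    using G unfolding span_iso_iff by blast
  have fh': "f' \<in> homset C (Dom C m') (Cod C f)" using comp_in_hom[OF i(2) f] i(4) by simp
  note d = is_pullbackD[OF pb] and d' = is_pullbackD[OF pb']
  have ph': "p' \<in> homset C (Dom C p') (Dom C m')" using d'(4) in_homsetD(2)[OF fh'] by simp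
  have "is_pullback C f n' (i \<cdot> p') q'"
    using pullback_comp_isomorphism[of f i n' p' q'] pb' i D in_homsetD(1)[OF f] by simp
  from pullback_sym[OF this] have "is_pullback C n f (j \<cdot> q') (i \<cdot> p')"
    using pullback_comp_isomorphism[of n j f] j in_homsetD(1)[OF n] by simp
  from pullback_sym[OF this] have pb'': "is_pullback C f n (i \<cdot> p') (j \<cdot> q')" .
  obtain k where k: "k \<in> isomorphisms C" "k \<in> homset C (Dom C (i \<cdot> p')) (Dom C p)"
    "i \<cdot> p' = p \<cdot> k" "j \<cdot> q' = q \<cdot> k" using pullback_unique[OF pb'' pb] .
  have k2: "k \<in> homset C (Dom C p') (Dom C p)"
    using k(2) in_homsetD(2)[OF comp_in_hom[OF ph' i(2)]] by simp
  have p: "p \<in> homset C (Dom C p) (Dom C m)" using d(4) D by simp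
  have eqs: "m' \<cdot> p' = (m \<cdot> p) \<cdot> k" "g' \<cdot> q' = (g \<cdot> q) \<cdot> k"
    using i j k comp_assoc[OF ph' i(2) m] comp_assoc[OF k2 p m]
      comp_assoc[OF d'(5) j(2) g] comp_assoc[OF k2 d(5) g] by auto
  have mp: "m \<cdot> p \<in> homset C (Dom C p) (Cod C m)" and gq: "g \<cdot> q \<in> homset C (Dom C p) (Cod C g)"
    using comp_in_hom[OF p m] comp_in_hom[OF d(5) g] by auto
  have nM: "n \<in> M" "m \<in> M" using s by (auto simp: spans_iff)
  have pM: "p \<in> M" using pullback_M[OF pb nM(1)] .
  have mpM: "m \<cdot> p \<in> M" using comp_in_M[OF pM nM(2)] in_homsetD(3)[OF p] by simp
  have kM: "k \<in> M" using k(1) iso_in_M by blast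
  have s1: "(m \<cdot> p, g \<cdot> q) \<in> spans C M"
    using mpM mp gq by (simp add: spans_def homset_def)
  have mpk: "(m \<cdot> p) \<cdot> k \<in> homset C (Dom C p') (Cod C m)"
    and gqk: "(g \<cdot> q) \<cdot> k \<in> homset C (Dom C p') (Cod C g)"
    using comp_in_hom[OF k2 mp] comp_in_hom[OF k2 gq] by auto
  have s2: "(m' \<cdot> p', g' \<cdot> q') \<in> spans C M"
    unfolding eqs using comp_in_M[OF kM mpM] mpk gqk in_homsetD(3)[OF k2] mp
    by (simp add: spans_def homset_def)
  show ?thesis
    unfolding span_class_eq_iff[OF s2 s1]
    using k(1) k2 eqs mpk mp by (auto simp: homset_def)
qed

lemma Comp_span_class:
  assumes "(m, f) \<in> spans C M" "(n, g) \<in> spans C M" "is_pullback C f n p q"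
  shows "span_class C M n g \<cdot>\<^bsub>Par C M\<^esub> span_class C M m f = span_class C M (m \<cdot> p) (g \<cdot> q)"
proof -
  have "{span_class C M (m' \<cdot> p') (g' \<cdot> q') | m' f' n' g' p' q'.
      (m', f') \<in> span_class C M m f \<and> (n', g') \<in> span_class C M n g \<and> is_pullback C f' n' p' q'}
    = {span_class C M (m \<cdot> p) (g \<cdot> q)}" (is "?L = ?R")
  proof
    show "?L \<subseteq> ?R"
      unfolding mem_span_class_iff using Comp_span_class_reps[OF assms] span_iso_sym by blast
    show "?R \<subseteq> ?L"
      unfolding mem_span_class_iff using assms span_iso_refl by blast
  qed
  then show ?thesis by (simp add: Par_def)
qed

section \<open>Total maps, and the order on restriction idempotents\<close>

lemma M_spans: "m \<in> M \<Longrightarrow> (m, m) \<in> spans C M"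
  using M_hom by (simp add: spans_iff)

lemma hom_spans: "f \<in> homset C A B \<Longrightarrow> (Id C A, f) \<in> spans C M"
  using id_in_M id_in_hom hom_Obj(1) by (auto simp: spans_def homset_def)

lemma Id_Par: "Id (Par C M) A = span_class C M (Id C A) (Id C A)"
  by (simp add: Par_def)

lemma total_comp_span_class:
  assumes "(m, f) \<in> spans C M" "g \<in> homset C (Cod C f) B"
  shows "span_class C M (Id C (Cod C f)) g \<cdot>\<^bsub>Par C M\<^esub> span_class C M m f = span_class C M m (g \<cdot> f)"
proof -
  have f: "f \<in> homset C (Dom C m) (Cod C f)" and m: "m \<in> M" using assms(1) by (auto simp: spans_iff)
  show ?thesis
    using Comp_span_class[OF assms(1) hom_spans[OF assms(2)] pullback_id_right[OF f]]
      comp_id[OF M_hom[OF m]] by simp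
qed

lemma comp_total_span_class:
  assumes "(n, g) \<in> spans C M" "f \<in> homset C A (Cod C n)" "is_pullback C f n p q"
  shows "span_class C M n g \<cdot>\<^bsub>Par C M\<^esub> span_class C M (Id C A) f = span_class C M p (g \<cdot> q)"
proof -
  have "p \<in> homset C (Dom C p) A"
    using is_pullbackD(4)[OF assms(3)] in_homsetD(2)[OF assms(2)] by simp
  then show ?thesis
    using Comp_span_class[OF hom_spans[OF assms(2)] assms(1,3)] id_comp by simp
qed

text \<open>Totality identifies the class of \<open>(m, m)\<close> with that of the identity span,
  which yields an isomorphism \<open>i\<close> with \<open>m \<cdot> i\<close> the identity. The
  same \<open>i\<close> shows that \<open>f \<cdot> i\<close> is the arrow sought.\<close>

lemma total_span_classE:
  assumes "F \<in> homset (Par C M) A B" "par_restr C M F = Id (Par C M) A"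
  obtains y where "y \<in> homset C A B" "F = span_class C M (Id C A) y"
proof -
  obtain m f where mf: "(m, f) \<in> spans C M" "Cod C m = A" "Cod C f = B" "F = span_class C M m f"
    using assms(1) by (rule Par_homE)
  have m: "m \<in> M" and f: "f \<in> homset C (Dom C m) B" using mf by (auto simp: spans_iff)
  have A: "A \<in> Obj C" using hom_Obj(2)[OF M_hom[OF m]] mf(2) by simp
  note Id = id_in_hom[OF A]
  have "span_class C M (Id C A) (Id C A) = span_class C M m m"
    using assms(2) par_restr_span_class[OF mf(1)] mf(4) Id_Par by simp
  then obtain i where i: "i \<in> isomorphisms C" "i \<in> homset C A (Dom C m)" "Id C A = m \<cdot> i"
    unfolding span_class_eq_iff[OF hom_spans[OF Id] M_spans[OF m]] in_homsetD(2)[OF Id] by blast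
  have fi: "f \<cdot> i \<in> homset C A B" using comp_in_hom[OF i(2) f] .
  have "span_class C M (Id C A) (f \<cdot> i) = span_class C M m f"
    unfolding span_class_eq_iff[OF hom_spans[OF fi] mf(1)] in_homsetD(2)[OF Id] using i by blast
  with that fi mf(4) show ?thesis by metis
qed

text \<open>The hypothesis is the restriction order between two idempotents of
  \<open>Par C M\<close>; the conclusion is the order of \<open>Sub\<close>. The right leg
  \<open>m \<cdot> q\<close> of the composite span supplies the factorization through
  \<open>m\<close>.\<close>

lemma le_span_class_factors:
  assumes a: "a \<in> M" and m: "m \<in> M" and cod: "Cod C a = Cod C m"
    and le: "span_class C M a a = span_class C M m m \<cdot>\<^bsub>Par C M\<^esub> span_class C M a a"
  obtains k where "k \<in> homset C (Dom C a) (Dom C m)" "a = m \<cdot> k"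
proof -
  obtain p q where pb: "is_pullback C a m p q" "p \<in> M"
    using pullback_in_M[OF m M_Arr[OF a] cod] by blast
  note d = is_pullbackD[OF pb(1)]
  have ap: "a \<cdot> p \<in> homset C (Dom C p) (Cod C a)" using comp_in_hom[OF d(4) M_hom[OF a]] .
  have "a \<cdot> p \<in> M" using comp_in_M[OF pb(2) a] in_homsetD(3)[OF d(4)] by simp
  then have s: "(a \<cdot> p, m \<cdot> q) \<in> spans C M" using d(6) M_spans by metis
  have "span_class C M a a = span_class C M (a \<cdot> p) (m \<cdot> q)"
    using le Comp_span_class[OF M_spans[OF a] M_spans[OF m] pb(1)] by simp
  then obtain i where i: "i \<in> homset C (Dom C a) (Dom C p)" "a = (m \<cdot> q) \<cdot> i"
    unfolding span_class_eq_iff[OF M_spans[OF a] s] in_homsetD(2)[OF ap] by blast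
  have "a = m \<cdot> (q \<cdot> i)" using i(2) comp_assoc[OF i(1) d(5) M_hom[OF m]] by simp
  then show ?thesis using that comp_in_hom[OF i(1) d(5)] by blast
qed

section \<open>Basic covers in the subobject poset\<close>

lemma sub_class_self: "m \<in> M \<Longrightarrow> m \<in> sub_class C M m"
  using id_isomorphism id_in_hom comp_id[OF M_hom] hom_Obj(1)[OF M_hom]
  by (fastforce simp: sub_class_def sub_iso_def)

lemma sub_class_carrier: "m \<in> M \<Longrightarrow> Cod C m = X \<Longrightarrow> sub_class C M m \<in> carrier (Sub C M X)"
  by (auto simp: Sub_def sub_class_def intro: quotientI)

text \<open>As an upper bound of the cover, \<open>m\<close> lies above the join, which is the
  identity. So \<open>m\<close> has a section, and a monic with a section is an isomorphism.\<close>

lemma cover_upper_bound_iso: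
  assumes R: "R \<in> M_covers C M X" and X: "X \<in> Obj C" and m: "m \<in> M" "Cod C m = X"
    and fac: "\<And>a. a \<in> R \<Longrightarrow> \<exists>k \<in> homset C (Dom C a) (Dom C m). a = m \<cdot> k"
  shows "span_class C M m m = Id (Par C M) X"
proof -
  note Id = id_in_hom[OF X]
  have "sub_class C M m \<in> Upper (Sub C M X) (sub_class C M ` R)"
    unfolding Upper_def
  proof (clarsimp simp: sub_class_carrier m)
    fix a assume "a \<in> R"
    moreover from this have "a \<in> M" using R by (auto simp: M_covers_def)
    ultimately show "sub_class C M a \<sqsubseteq>\<^bsub>Sub C M X\<^esub> sub_class C M m"
      using fac[of a] sub_class_self[of a] sub_class_self[OF m(1)] by (auto simp: Sub_def)
  qed
  then have "sub_class C M (Id C X) \<sqsubseteq>\<^bsub>Sub C M X\<^esub> sub_class C M m"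
    using R by (auto simp: M_covers_def is_join_def least_def)
  \<comment> \<open>The order of \<open>Sub\<close> yields unspecified representatives, so the
    factorization has to be transported back to \<open>Id C X\<close> and \<open>m\<close>.\<close>
  then obtain n m' k where n: "n \<in> sub_class C M (Id C X)" and m': "m' \<in> sub_class C M m"
    and k: "k \<in> homset C (Dom C n) (Dom C m')" "n = m' \<cdot> k"
    unfolding Sub_def by auto
  obtain i where i: "i \<in> homset C X (Dom C n)" "Id C X = n \<cdot> i"
    using n in_homsetD[OF Id] by (auto simp: sub_class_def sub_iso_def)
  obtain j where j: "j \<in> isomorphisms C" "j \<in> homset C (Dom C m) (Dom C m')" "m = m' \<cdot> j"
    and m'M: "m' \<in> M" using m' by (auto simp: sub_class_def sub_iso_def)
  obtain j' where j': "j' \<in> homset C (Dom C m') (Dom C m)" "j \<cdot> j' = Id C (Dom C m')"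
    using j(1,2) by (rule isomorphismE)
  note mh = M_hom[OF m(1), unfolded m(2)]
  \<comment> \<open>The section of \<open>m\<close>: from \<open>X\<close> to
    \<open>Dom C n\<close>, then to \<open>Dom C m'\<close>, then to \<open>Dom C m\<close>.\<close>
  define s where "s = j' \<cdot> (k \<cdot> i)"
  have ki: "k \<cdot> i \<in> homset C X (Dom C m')" using comp_in_hom[OF i(1) k(1)] .
  have s: "s \<in> homset C X (Dom C m)" unfolding s_def using comp_in_hom[OF ki j'(1)] .
  have "m \<cdot> j' = m'"
    using j(3) comp_assoc[OF j'(1) j(2) M_hom[OF m'M]] j'(2) comp_id[OF M_hom[OF m'M]] by simp
  then have "m \<cdot> s = m' \<cdot> (k \<cdot> i)" unfolding s_def using comp_assoc[OF ki j'(1) mh] by simp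
  also have "\<dots> = Id C X" using comp_assoc[OF i(1) k(1) M_hom[OF m'M]] k(2) i(2) by simp
  finally have ms: "m \<cdot> s = Id C X" .
  have sm: "s \<cdot> m = Id C (Dom C m)"
  proof (rule M_cancel[OF m(1) comp_in_hom[OF mh s] id_in_hom[OF hom_Obj(1)[OF mh]]])
    show "m \<cdot> (s \<cdot> m) = m \<cdot> Id C (Dom C m)"
      using comp_assoc[OF mh s mh] ms id_comp[OF mh] comp_id[OF mh] by simp
  qed
  have "m \<in> isomorphisms C" using isomorphismI[OF mh s sm ms] .
  then show ?thesis
    unfolding Id_Par span_class_eq_iff[OF M_spans[OF m(1)] hom_spans[OF Id]] in_homsetD(2)[OF Id]
    using mh id_comp[OF mh] by auto
qed

end

section \<open>Sheaves on a geometric M-category\<close>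

sublocale geometric_M_category \<subseteq> Par: join_restriction_category "Par C M" "par_restr C M"
  by (rule geometric)

context geometric_M_category
begin

lemma Obj_Par: "Obj (Par C M) = Obj C"
  by (simp add: Par_def)

lemma cover_idem:
  assumes "R \<in> M_covers C M X" "e \<in> (\<lambda>a. span_class C M a a) ` R"
  shows "e \<in> homset (Par C M) X X" "par_restr C M e = e"
  using assms span_class_in_hom[OF M_spans] par_restr_span_class[OF M_spans]
  by (auto simp: M_covers_def)

text \<open>
  Upper bounds in the hom-poset need not be restriction idempotents, hence do not give elements of
  \<open>Sub C M X\<close>. The proof therefore takes the join in \<open>Par C M\<close>, which is an idempotent by (J1), and
  identifies it with the identity.
\<close>

lemma cover_join_Par:
  assumes R: "R \<in> M_covers C M X" and X: "X \<in> Obj C"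
  shows "is_join (hom_poset (Par C M) (par_restr C M) X X) ((\<lambda>a. span_class C M a a) ` R) (Id (Par C M) X)"
proof -
  define E where "E = (\<lambda>a. span_class C M a a) ` R"
  have E: "E \<subseteq> homset (Par C M) X X" "\<And>e. e \<in> E \<Longrightarrow> par_restr C M e = e"
    unfolding E_def using cover_idem[OF R] by blast+
  obtain J where J: "is_join (hom_poset (Par C M) (par_restr C M) X X) E J"
    "is_join (hom_poset (Par C M) (par_restr C M) X X) (par_restr C M ` E) (par_restr C M J)"
    using Par.joins[OF _ _ E(1) Par.idems_compatible[OF E]] X Obj_Par by metis
  have Jup: "J \<in> homset (Par C M) X X" "\<And>e. e \<in> E \<Longrightarrow> e = J \<cdot>\<^bsub>Par C M\<^esub> par_restr C M e"
    using J(1) unfolding Par.is_join_hom_poset_iff[OF E(1)] by auto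
  have "par_restr C M ` E = E" using E(2) by force
  then have rJ: "par_restr C M J = J" using Par.is_join_unique[OF E(1) J(1)] J(2) by metis
  obtain m f where mf: "(m, f) \<in> spans C M" "Cod C m = X" "Cod C f = X" "J = span_class C M m f"
    using Jup(1) by (rule Par_homE)
  have m: "m \<in> M" using mf(1) by (simp add: spans_iff)
  have Jm: "J = span_class C M m m" using rJ par_restr_span_class[OF mf(1)] mf(4) by simp
  have "\<exists>k \<in> homset C (Dom C a) (Dom C m). a = m \<cdot> k" if a: "a \<in> R" for a
  proof -
    have aM: "a \<in> M" "Cod C a = Cod C m" using a R mf(2) by (auto simp: M_covers_def)
    have e: "span_class C M a a \<in> E" using a by (simp add: E_def)
    have "span_class C M a a = span_class C M m m \<cdot>\<^bsub>Par C M\<^esub> span_class C M a a"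
      using Jup(2)[OF e] E(2)[OF e] Jm by metis
    then obtain k where "k \<in> homset C (Dom C a) (Dom C m)" "a = m \<cdot> k"
      by (rule le_span_class_factors[OF aM(1) m aM(2)])
    then show ?thesis by blast
  qed
  \<comment> \<open>The factorizations make \<open>m\<close> an upper bound of \<open>R\<close> in
    \<open>Sub C M X\<close>, where the join of \<open>R\<close> is the identity.\<close>
  then have "J = Id (Par C M) X" using cover_upper_bound_iso[OF R X m mf(2)] Jm by simp
  then show ?thesis using J(1) unfolding E_def by simp
qed

lemma total_restr: "f \<in> homset C A B \<Longrightarrow> par_restr C M (span_class C M (Id C A) f) = Id (Par C M) A"
  using par_restr_span_class[OF hom_spans] Id_Par by simp

lemma total_in_hom: "f \<in> homset C A B \<Longrightarrow> span_class C M (Id C A) f \<in> homset (Par C M) A B"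
  using span_class_in_hom[OF hom_spans] in_homsetD(3) in_homsetD(3)[OF id_in_hom[OF hom_Obj(1)]] by metis

text \<open>The pullbacks of the members of \<open>R\<close> along \<open>f\<close> are jointly
  epic. This general form is needed because an arrow of a sieve need not factor through a member of
  the basic cover; it does so only after restriction to these pullbacks.\<close>

lemma pullback_cover_jointly_epic:
  assumes R: "R \<in> M_covers C M X" and f: "f \<in> homset C A X"
    and u: "u \<in> homset C A Y" and v: "v \<in> homset C A Y"
    and eq: "\<And>a p q. a \<in> R \<Longrightarrow> is_pullback C f a p q \<Longrightarrow> u \<cdot> p = v \<cdot> p"
  shows "u = v"
proof -
  note O = hom_Obj[OF f]
  define E where "E = (\<lambda>a. span_class C M a a) ` R"
  define g where "g = span_class C M (Id C A) f"
  \<comment> \<open>The pulled-back cover as a set of idempotents: for \<open>a\<close> in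
    \<open>R\<close>, the restriction of the partial map \<open>(p, a \<cdot> q)\<close>, which is
    the class of \<open>(p, p)\<close>.\<close>
  define E' where "E' = (\<lambda>e. par_restr C M (e \<cdot>\<^bsub>Par C M\<^esub> g)) ` E"
  have g: "g \<in> homset (Par C M) A X" "par_restr C M g = Id (Par C M) A"
    unfolding g_def using total_in_hom total_restr f by auto
  have join: "is_join (hom_poset (Par C M) (par_restr C M) A A) E' (Id (Par C M) A)"
    using Par.join_restr_comp[OF g(1) _ _ cover_join_Par[OF R O(2)]] cover_idem[OF R] g(2)
    unfolding E'_def E_def by auto
  have E': "e \<in> homset (Par C M) A A \<and> par_restr C M e = e \<and>
      span_class C M (Id C A) u \<cdot>\<^bsub>Par C M\<^esub> e = span_class C M (Id C A) v \<cdot>\<^bsub>Par C M\<^esub> e"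
    if "e \<in> E'" for e
  proof -
    obtain a where a: "a \<in> R" and e: "e = par_restr C M (span_class C M a a \<cdot>\<^bsub>Par C M\<^esub> g)"
      using \<open>e \<in> E'\<close> unfolding E'_def E_def by blast
    have aM: "a \<in> M" "Cod C a = X" using R a by (auto simp: M_covers_def)
    obtain p q where pb: "is_pullback C f a p q" "p \<in> M"
      using pullback_in_M[OF aM(1) in_homsetD(1)[OF f]] in_homsetD(3)[OF f] aM(2) by metis
    note d = is_pullbackD[OF pb(1)]
    have "a \<cdot> q \<in> homset C (Dom C p) (Cod C a)" using comp_in_hom[OF d(5) M_hom[OF aM(1)]] .
    then have s: "(p, a \<cdot> q) \<in> spans C M" using pb(2) by (simp add: spans_def homset_def)
    have cod: "Cod C p = A" using in_homsetD[OF d(4)] in_homsetD[OF f] by simp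
    have "f \<in> homset C A (Cod C a)" using f aM(2) by simp
    from comp_total_span_class[OF M_spans[OF aM(1)] this pb(1)] have ep: "e = span_class C M p p"
      unfolding e g_def using par_restr_span_class[OF s] by simp
    note p = M_spans[OF pb(2)]
    have "span_class C M (Id C A) w \<cdot>\<^bsub>Par C M\<^esub> e = span_class C M p (w \<cdot> p)"
      if "w \<in> homset C A Y" for w
      unfolding ep using total_comp_span_class[OF p, unfolded cod, OF that] .
    then show ?thesis
      unfolding ep using span_class_in_hom[OF p] par_restr_span_class[OF p] u v cod eq[OF a pb(1)]
      by simp
  qed
  have "span_class C M (Id C A) u = span_class C M (Id C A) v"
    using Par.total_eq_on_join[OF total_in_hom[OF u] total_restr[OF u]
        total_in_hom[OF v] total_restr[OF v] _ _ join] E' by blast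
  then show ?thesis using span_class_inject[OF hom_spans[OF u] hom_spans[OF v]] by simp
qed

lemma cover_jointly_epic:
  assumes R: "R \<in> M_covers C M X" and u: "u \<in> homset C X Y" and v: "v \<in> homset C X Y"
    and eq: "\<And>a. a \<in> R \<Longrightarrow> u \<cdot> a = v \<cdot> a"
  shows "u = v"
proof (rule pullback_cover_jointly_epic[OF R id_in_hom[OF hom_Obj(1)[OF u]] u v])
  fix a p q assume a: "a \<in> R" and pb: "is_pullback C (Id C X) a p q"
  note d = is_pullbackD[OF pb] and Id = id_in_hom[OF hom_Obj(1)[OF u]]
  have ah: "a \<in> homset C (Dom C a) X" using R a M_hom by (auto simp: M_covers_def)
  have "p \<in> homset C (Dom C p) X" using d(4) in_homsetD[OF Id] by simp
  then have "p = a \<cdot> q" using d(6) id_comp[of p] by simp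
  then show "u \<cdot> p = v \<cdot> p"
    using comp_assoc[OF d(5) ah u] comp_assoc[OF d(5) ah v] eq[OF a] by simp
qed

lemma cover_amalgamation:
  assumes R: "R \<in> M_covers C M X" and X: "X \<in> Obj C" and Y: "Y \<in> Obj C"
    and x: "\<And>a. a \<in> R \<Longrightarrow> x a \<in> homset C (Dom C a) Y"
    and match: "\<And>a b p q. a \<in> R \<Longrightarrow> b \<in> R \<Longrightarrow> is_pullback C a b p q \<Longrightarrow> x a \<cdot> p = x b \<cdot> q"
  obtains y where "y \<in> homset C X Y" "\<And>a. a \<in> R \<Longrightarrow> y \<cdot> a = x a"
proof -
  have aM: "a \<in> M" "Cod C a = X" if "a \<in> R" for a using that R by (auto simp: M_covers_def)
  have sp: "(a, x a) \<in> spans C M" "Cod C (x a) = Y" if "a \<in> R" for a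
    using aM[OF that] in_homsetD[OF x[OF that]] by (auto simp: spans_def)
  define S where "S = (\<lambda>a. span_class C M a (x a)) ` R"
  have S: "S \<subseteq> homset (Par C M) X Y"
    unfolding S_def using sp aM span_class_in_hom by blast
  have rS: "par_restr C M ` S = (\<lambda>a. span_class C M a a) ` R"
    unfolding S_def image_image using sp par_restr_span_class by (intro image_cong) auto
  have comp: "compatible_set (Par C M) (par_restr C M) S"
    unfolding compatible_set_def S_def
  proof clarify
    fix a b assume a: "a \<in> R" and b: "b \<in> R"
    obtain p q where pb: "is_pullback C a b p q" "p \<in> M"
      using pullback_in_M[OF aM(1)[OF b] M_Arr[OF aM(1)[OF a]]] aM(2) a b by metis
    \<comment> \<open>Here \<open>(b, b)\<close> is applied first, so the pullback square is read
      with its legs exchanged. The two composites then have equal left legs by commutativity of the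
      square, and equal right legs by \<open>match\<close>.\<close>
    have "span_class C M a (x a) \<cdot>\<^bsub>Par C M\<^esub> span_class C M b b = span_class C M (b \<cdot> q) (x a \<cdot> p)"
      using Comp_span_class[OF M_spans[OF aM(1)[OF b]] sp(1)[OF a] pullback_sym[OF pb(1)]] .
    also have "\<dots> = span_class C M (a \<cdot> p) (x b \<cdot> q)"
      using match[OF a b pb(1)] is_pullbackD(6)[OF pb(1)] by simp
    also have "\<dots> = span_class C M b (x b) \<cdot>\<^bsub>Par C M\<^esub> span_class C M a a"
      using Comp_span_class[OF M_spans[OF aM(1)[OF a]] sp(1)[OF b] pb(1)] by simp
    finally show "span_class C M a (x a) \<cdot>\<^bsub>Par C M\<^esub> par_restr C M (span_class C M b (x b)) =
        span_class C M b (x b) \<cdot>\<^bsub>Par C M\<^esub> par_restr C M (span_class C M a (x a))"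
      using par_restr_span_class sp a b by simp
  qed
  obtain J where J: "J \<in> homset (Par C M) X Y" "par_restr C M J = Id (Par C M) X"
    "\<And>s. s \<in> S \<Longrightarrow> s = J \<cdot>\<^bsub>Par C M\<^esub> par_restr C M s"
    using Par.compatible_amalgamation[OF _ _ S comp] cover_join_Par[OF R X] rS X Y Obj_Par by metis
  obtain y where y: "y \<in> homset C X Y" "J = span_class C M (Id C X) y"
    using J(1,2) by (rule total_span_classE)
  show ?thesis
  proof (rule that[OF y(1)])
    fix a assume a: "a \<in> R"
    note am = aM[OF a]
    have ya: "y \<cdot> a \<in> homset C (Dom C a) Y" using comp_in_hom[OF _ y(1)] M_hom[OF am(1)] am(2) by simp
    \<comment> \<open>Being below the join \<open>J\<close>, the partial map \<open>(a, x a)\<close>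
      is \<open>J\<close> restricted to \<open>a\<close>. Both spans have the left leg
      \<open>a\<close>, so their right legs can be compared.\<close>
    have "span_class C M a (x a) = J \<cdot>\<^bsub>Par C M\<^esub> span_class C M a a"
      using J(3)[of "span_class C M a (x a)"] par_restr_span_class[OF sp(1)[OF a]] a
      unfolding S_def by (metis imageI)
    also have "\<dots> = span_class C M a (y \<cdot> a)"
      using total_comp_span_class[OF M_spans[OF am(1)]] am(2) y by simp
    finally have "span_class C M a (x a) = span_class C M a (y \<cdot> a)" .
    moreover have "(a, y \<cdot> a) \<in> spans C M" using am(1) ya by (simp add: spans_def homset_def)
    ultimately show "y \<cdot> a = x a" using span_class_inject[OF sp(1)[OF a]] by simp
  qed
qed

lemma hom_presheaf_amalgamation:
  assumes S: "S \<in> generated_topology C (M_covers C M) X" and X: "X \<in> Obj C" and Y: "Y \<in> Obj C"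
    and x: "matching_family C (hom_presheaf C Y) S x"
  shows "\<exists>!y. y \<in> homset C X Y \<and> (\<forall>f \<in> S. y \<cdot> f = x f)"
proof -
  obtain R where R: "R \<in> M_covers C M X" "R \<subseteq> S" and sieve: "S \<in> sieves C X"
    using S by (auto simp: generated_topology_def)
  have Sh: "f \<in> homset C (Dom C f) X" if "f \<in> S" for f
    using that sieve by (auto simp: sieves_def homset_def)
  have xh: "x f \<in> homset C (Dom C f) Y" if "f \<in> S" for f
    using that x by (auto simp: matching_family_def hom_presheaf_def)
  have xc: "x (f \<cdot> g) = x f \<cdot> g" if "f \<in> S" "g \<in> homset C A (Dom C f)" for f g A
    using that x in_homsetD[OF that(2)] by (auto simp: matching_family_def hom_presheaf_def)
  \<comment> \<open>Both sides are the value of \<open>x\<close> at the common arrow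
    \<open>f \<cdot> p = g \<cdot> q\<close>.\<close>
  have match: "x f \<cdot> p = x g \<cdot> q" if "f \<in> S" "g \<in> S" "is_pullback C f g p q" for f g p q
    using that is_pullbackD[OF that(3)] xc by metis
  obtain y where y: "y \<in> homset C X Y" "\<And>a. a \<in> R \<Longrightarrow> y \<cdot> a = x a"
    using cover_amalgamation[OF R(1) X Y, of x] xh match R(2) by (metis subsetD)
  \<comment> \<open>The arrow \<open>y\<close> is controlled on \<open>R\<close> only, so equality
    is tested on the pullbacks of \<open>R\<close> along \<open>f\<close>, where
    \<open>f \<cdot> p = a \<cdot> q\<close> factors through a member of \<open>R\<close>.\<close>
  have "y \<cdot> f = x f" if f: "f \<in> S" for f
  proof (rule pullback_cover_jointly_epic[OF R(1) Sh[OF f] comp_in_hom[OF Sh[OF f] y(1)] xh[OF f]])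
    fix a p q assume a: "a \<in> R" and pb: "is_pullback C f a p q"
    note d = is_pullbackD[OF pb]
    have aS: "a \<in> S" using a R(2) by blast
    have "(y \<cdot> f) \<cdot> p = (y \<cdot> a) \<cdot> q"
      using comp_assoc[OF d(4) Sh[OF f] y(1)] comp_assoc[OF d(5) Sh[OF aS] y(1)] d(6) by simp
    also have "\<dots> = x f \<cdot> p" using y(2)[OF a] match[OF f aS pb] by simp
    finally show "(y \<cdot> f) \<cdot> p = x f \<cdot> p" .
  qed
  moreover have "z = y" if "z \<in> homset C X Y" "\<forall>f \<in> S. z \<cdot> f = x f" for z
    using cover_jointly_epic[OF R(1) that(1) y(1)] that(2) y(2) R(2) by auto
  ultimately show ?thesis using y(1) by blast
qed

text \<open>The sheaf condition is invariant under isomorphism of presheaves, so the matching family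
  is carried back along \<open>\<eta>\<close> to a hom-presheaf and its amalgamation is carried
  forward.\<close>

lemma representable_is_sheaf:
  assumes "representable C F"
  shows "is_sheaf C (generated_topology C (M_covers C M)) F"
  unfolding is_sheaf_def
proof (intro conjI ballI allI impI)
  show "is_presheaf C F" using assms by (simp add: representable_def)
  obtain Y \<eta> where Y: "Y \<in> Obj C" and \<eta>: "presheaf_iso C (hom_presheaf C Y) F \<eta>"
    using assms by (auto simp: representable_def)
  have bij: "bij_betw (\<eta> A) (homset C A Y) (PObj F A)" if "A \<in> Obj C" for A
    using \<eta> that by (simp add: presheaf_iso_def hom_presheaf_def)
  have nat: "\<eta> (Dom C f) (z \<cdot> f) = PMap F f (\<eta> (Cod C f) z)"
    if "f \<in> Arr C" "z \<in> homset C (Cod C f) Y" for f z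
    using \<eta> that by (simp add: presheaf_iso_def hom_presheaf_def)
  fix X S x
  assume X: "X \<in> Obj C" and S: "S \<in> generated_topology C (M_covers C M) X"
    and x: "matching_family C F S x"
  have Sh: "f \<in> Arr C" "Cod C f = X" "Dom C f \<in> Obj C" if "f \<in> S" for f
    using that S dom_in_Obj by (auto simp: generated_topology_def sieves_def)
  have Sc: "f \<cdot> g \<in> S" if "f \<in> S" "g \<in> Arr C" "Cod C g = Dom C f" for f g
    using that S by (auto simp: generated_topology_def sieves_def)
  define x' where "x' f = the_inv_into (homset C (Dom C f) Y) (\<eta> (Dom C f)) (x f)" for f
  have x': "x' f \<in> homset C (Dom C f) Y" "\<eta> (Dom C f) (x' f) = x f" if "f \<in> S" for f
  proof -
    have "x f \<in> PObj F (Dom C f)" using x that by (simp add: matching_family_def)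
    then show "x' f \<in> homset C (Dom C f) Y" "\<eta> (Dom C f) (x' f) = x f"
      using bij[OF Sh(3)[OF that]] the_inv_into_into f_the_inv_into_f unfolding x'_def bij_betw_def
      by fastforce+
  qed
  \<comment> \<open>Compared after applying the injective component of \<open>\<eta>\<close> at
    \<open>Dom C g\<close>, where naturality turns precomposition with \<open>g\<close> into
    \<open>PMap F g\<close>.\<close>
  have "x' (f \<cdot> g) = x' f \<cdot> g" if f: "f \<in> S" and g: "g \<in> Arr C" "Cod C g = Dom C f" for f g
  proof -
    have gh: "g \<in> homset C (Dom C g) (Dom C f)" and fh: "f \<in> homset C (Dom C f) X"
      using g Sh[OF f] by (auto simp: homset_def)
    have D: "Dom C (f \<cdot> g) = Dom C g" using in_homsetD(2)[OF comp_in_hom[OF gh fh]] .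
    note fg = Sc[OF f g]
    have "\<eta> (Dom C g) (x' (f \<cdot> g)) = x (f \<cdot> g)" using x'(2)[OF fg] D by simp
    also have "\<dots> = PMap F g (x f)" using x f g by (simp add: matching_family_def)
    also have "\<dots> = \<eta> (Dom C g) (x' f \<cdot> g)" using nat[OF g(1)] x'[OF f] g(2) by simp
    finally have "\<eta> (Dom C g) (x' (f \<cdot> g)) = \<eta> (Dom C g) (x' f \<cdot> g)" .
    moreover have "x' (f \<cdot> g) \<in> homset C (Dom C g) Y" "x' f \<cdot> g \<in> homset C (Dom C g) Y"
      using x'(1)[OF fg] D comp_in_hom[OF gh x'(1)[OF f]] by auto
    ultimately show ?thesis
      using bij[OF dom_in_Obj[OF g(1)]] by (auto simp: bij_betw_def dest: inj_onD)
  qed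
  then have "matching_family C (hom_presheaf C Y) S x'"
    using x'(1) by (simp add: matching_family_def hom_presheaf_def)
  from hom_presheaf_amalgamation[OF S X Y this]
  obtain y where y: "y \<in> homset C X Y" "\<And>f. f \<in> S \<Longrightarrow> y \<cdot> f = x' f"
    and uniq: "\<And>z. z \<in> homset C X Y \<Longrightarrow> (\<forall>f \<in> S. z \<cdot> f = x' f) \<Longrightarrow> z = y" by metis
  show "\<exists>!z. z \<in> PObj F X \<and> (\<forall>f \<in> S. PMap F f z = x f)"
  proof (rule ex1I)
    show "\<eta> X y \<in> PObj F X \<and> (\<forall>f \<in> S. PMap F f (\<eta> X y) = x f)"
      using bij_betwE[OF bij[OF X]] y nat[of _ y] Sh x'(2) by metis
    fix z assume z: "z \<in> PObj F X \<and> (\<forall>f \<in> S. PMap F f z = x f)"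
    then obtain w where w: "w \<in> homset C X Y" "z = \<eta> X w"
      using bij[OF X] by (auto simp: bij_betw_def)
    have "w \<cdot> f = x' f" if f: "f \<in> S" for f
    proof -
      have wf: "w \<cdot> f \<in> homset C (Dom C f) Y"
        using comp_in_hom[of f "Dom C f" X w Y] Sh[OF f] w(1) by (simp add: homset_def)
      have "\<eta> (Dom C f) (w \<cdot> f) = \<eta> (Dom C f) (x' f)"
        using nat[of f w] Sh[OF f] w z f x'(2)[OF f] by simp
      then show ?thesis
        using bij[OF Sh(3)[OF f]] wf x'(1)[OF f] by (auto simp: bij_betw_def dest: inj_onD)
    qed
    then show "z = \<eta> X y" using uniq[OF w(1)] w(2) by simp
  qed
qed

end

theorem lemma17:
  fixes C :: "('o, 'a) cat" and M :: "'a set"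
  assumes "geometric_M_category C M"
  shows "subcanonical TYPE('x) C (generated_topology C (M_covers C M))"
  unfolding subcanonical_def
  by (intro allI impI geometric_M_category.representable_is_sheaf[OF assms])

end
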